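(* Consider a deterministic Markov decision process (MDP) with a reachability objective, with finite state space $S$, target state $s^*\in S$, finite nonempty action sets $A(s)$ and transition probabilities $p(\cdot\mid s,a)$; that is, for each state $s\neq s^*$ and every action $a\in A(s)$ there is a state $z\in S$ such that $p(\{z,s^*\}\mid s,a)=1$. Then there exists a pure stationary strategy $\sigma$ such that, for every initial state $s\in S\setminus\{s^*\}$, no other pure strategy weakly overtakes $\sigma$ at the initial state $s$.
   Context: An MDP with a reachability objective is given by a finite set $S$ of states with a target state $s^*\in S$, for each $s\in S$ a nonempty finite set $A(s)$ of actions, and for each $s\in S$, $a\in A(s)$ a probability distribution $p(\cdot\mid s,a)$ on $S$. Play runs over periods $1,2,3,\ldots$: it starts at period 1 in an initial state $s_1\in S\setminus\{s^*\}$; at each period $t$ the decision maker chooses an action $a_t\in A(s_t)$ and $s_{t+1}$ is drawn from $p(\cdot\mid s_t,a_t)$. A history at period $t$ is a sequence $(s_1,a_1,\ldots,s_{t-1},a_{t-1},s_t)$ with $a_i\in A(s_i)$ and $p(s_{i+1}\mid s_i,a_i)>0$ for all $i<t$; its final state is $s_t$. A strategy $\sigma$ assigns to each history $h$ a probability distribution $\sigma(h)$ on $A(s)$, where $s$ is the final state of $h$. It is pure if every $\sigma(h)$ puts probability 1 on one action, and stationary if $\sigma(h)$ depends only on the final state of $h$. $\mathbb{P}_{s\sigma}$ denotes the probability measure on infinite histories induced by initial state $s$ and strategy $\sigma$. Let $t^*$ be the first period at which the state is $s^*$ ($t^*=\infty$ if $s^*$ is never reached). A strategy $\sigma'$ weakly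 overtakes a strategy $\sigma$ at the initial state $s$ if there is $T\in\mathbb{N}$ such that $\mathbb{P}_{s\sigma'}(t^*\leq t)\geq\mathbb{P}_{s\sigma}(t^*\leq t)$ for all $t\geq T$, with strict inequality for infinitely many $t$. *)

theory Defs
  imports "HOL-Probability.Probability"
begin

text \<open>
  The state set is the finite type \<open>'s\<close>, the action sets \<open>A s\<close> are subsets of the finite type \<open>'a\<close>,
  and \<open>p s a\<close> is relevant only for \<open>a \<in> A s\<close>.

  The history \<open>(s_1, a_1, \<dots>, s_(t-1), a_(t-1), s_t)\<close> is encoded as
  \<open>([(s_1, a_1), \<dots>, (s_(t-1), a_(t-1))], s_t)\<close>.
\<close>

type_synonym ('s, 'a) history = "('s \<times> 'a) list \<times> 's"

abbreviation final_state :: "('s, 'a) history \<Rightarrow> 's" where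
  "final_state h \<equiv> snd h"

definition history_states :: "('s, 'a) history \<Rightarrow> 's list" where
  "history_states h = map fst (fst h) @ [snd h]"

definition is_history ::
    "('s \<Rightarrow> 'a set) \<Rightarrow> ('s \<Rightarrow> 'a \<Rightarrow> 's pmf) \<Rightarrow> 's \<Rightarrow> ('s, 'a) history \<Rightarrow> bool" where
  "is_history A p target h \<longleftrightarrow>
     history_states h ! 0 \<noteq> target \<and>
     (\<forall>i < length (fst h).
        let s = history_states h ! i; a = snd (fst h ! i); s' = history_states h ! Suc i
        in a \<in> A s \<and> pmf (p s a) s' > 0)"

text \<open>
  Strategies are total functions; their values on arguments that are not histories
  are unconstrained and never matter.
\<close>

type_synonym ('s, 'a) strategy = "('s, 'a) history \<Rightarrow> 'a pmf"

definition is_strategy ::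
    "('s \<Rightarrow> 'a set) \<Rightarrow> ('s \<Rightarrow> 'a \<Rightarrow> 's pmf) \<Rightarrow> 's \<Rightarrow> ('s, 'a) strategy \<Rightarrow> bool" where
  "is_strategy A p target \<sigma> \<longleftrightarrow>
     (\<forall>h. is_history A p target h \<longrightarrow> set_pmf (\<sigma> h) \<subseteq> A (final_state h))"

definition is_pure ::
    "('s \<Rightarrow> 'a set) \<Rightarrow> ('s \<Rightarrow> 'a \<Rightarrow> 's pmf) \<Rightarrow> 's \<Rightarrow> ('s, 'a) strategy \<Rightarrow> bool" where
  "is_pure A p target \<sigma> \<longleftrightarrow> (\<forall>h. is_history A p target h \<longrightarrow> (\<exists>a. pmf (\<sigma> h) a = 1))"

definition is_stationary ::
    "('s \<Rightarrow> 'a set) \<Rightarrow> ('s \<Rightarrow> 'a \<Rightarrow> 's pmf) \<Rightarrow> 's \<Rightarrow> ('s, 'a) strategy \<Rightarrow> bool" where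
  "is_stationary A p target \<sigma> \<longleftrightarrow>
     (\<forall>h h'. is_history A p target h \<longrightarrow> is_history A p target h' \<longrightarrow>
        final_state h = final_state h' \<longrightarrow> \<sigma> h = \<sigma> h')"

text \<open>
  An infinite history is a function \<open>\<omega> :: nat \<Rightarrow> 's \<times> 'a\<close>, where \<open>\<omega> i\<close> is the state-action pair at
  period \<open>Suc i\<close>. The kernel below is the conditional law of \<open>\<omega> i\<close> given \<open>\<omega> 0, \<dots>, \<omega> (i - 1)\<close>:
  first the state is drawn from the transition law, then the action from the strategy.
\<close>

definition play_kernel ::
    "('s \<Rightarrow> 'a \<Rightarrow> 's pmf) \<Rightarrow> ('s, 'a) strategy \<Rightarrow> 's \<Rightarrow> nat \<Rightarrow> (nat \<Rightarrow> 's \<times> 'a) \<Rightarrow> ('s \<times> 'a) pmf" where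
  "play_kernel p \<sigma> s i \<omega> =
     bind_pmf (if i = 0 then return_pmf s else p (fst (\<omega> (i - 1))) (snd (\<omega> (i - 1))))
       (\<lambda>z. map_pmf (Pair z) (\<sigma> (map \<omega> [0..<i], z)))"

interpretation play: Ionescu_Tulcea
  "\<lambda>i \<omega>. measure_pmf (play_kernel p \<sigma> s i \<omega>)" "\<lambda>_. count_space (UNIV :: ('s :: finite \<times> 'a :: finite) set)"
  for p \<sigma> s
proof
  fix i :: nat
  let ?M = "PiM {0..<i} (\<lambda>_. count_space (UNIV :: ('s \<times> 'a) set))"
  have M: "?M = count_space (PiE {0..<i} (\<lambda>_. UNIV))"
    by (rule count_space_PiM_finite) auto
  show "(\<lambda>\<omega>. measure_pmf (play_kernel p \<sigma> s i \<omega>)) \<in> measurable ?M (subprob_algebra (count_space UNIV))"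
    unfolding M by (auto simp: space_subprob_algebra intro: measure_pmf.subprob_space_axioms)
qed

definition play_measure ::
    "('s :: finite \<Rightarrow> 'a :: finite \<Rightarrow> 's pmf) \<Rightarrow> ('s, 'a) strategy \<Rightarrow> 's \<Rightarrow> (nat \<Rightarrow> 's \<times> 'a) measure" where
  "play_measure p \<sigma> s = play.PF.lim p \<sigma> s"

lemma sets_play_measure [measurable_cong]:
  "sets (play_measure p \<sigma> s) = sets (PiM UNIV (\<lambda>_. count_space UNIV))"
  by (simp add: play_measure_def play.PF.sets_lim)

lemma space_play_measure: "space (play_measure p \<sigma> s) = UNIV"
  by (simp add: play_measure_def play.PF.space_lim space_PiM)

lemma prob_space_play_measure: "prob_space (play_measure p \<sigma> s)"
proof
  have "emeasure (play_measure p \<sigma> s) (play.PF.emb UNIV {} {\<lambda>_. undefined}) = emeasure (play.CI p \<sigma> s {}) {\<lambda>_. undefined}"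
    unfolding play_measure_def by (rule play.lim) (auto simp: PiM_empty)
  also have "\<dots> = 1"
    using prob_space.emeasure_space_1[OF play.PF.prob_space_P[of "{}" p \<sigma> s]]
    by (simp add: play.PF.space_P space_PiM)
  finally show "emeasure (play_measure p \<sigma> s) (space (play_measure p \<sigma> s)) = 1"
    by (simp add: space_play_measure prod_emb_def space_PiM restrict_def)
qed

definition hitting_time :: "'s \<Rightarrow> (nat \<Rightarrow> 's \<times> 'a) \<Rightarrow> enat" where
  "hitting_time target \<omega> = Inf {enat (Suc i) | i. fst (\<omega> i) = target}"

lemma hitting_time_le_iff:
  "hitting_time target \<omega> \<le> enat t \<longleftrightarrow> (\<exists>i<t. fst (\<omega> i) = target)"
proof
  assume le: "hitting_time target \<omega> \<le> enat t"
  let ?H = "{enat (Suc i) | i. fst (\<omega> i) = target}"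
  have "?H \<noteq> {}"
    proof
    assume "?H = {}"
    then have "hitting_time target \<omega> = \<infinity>"
      unfolding hitting_time_def by (simp only: Inf_enat_def) simp
    then show False using le by simp
  qed
  then have "Inf ?H \<in> ?H"
    by (metis (lifting) Inf_enat_def LeastI_ex ex_in_conv)
  then obtain i where "fst (\<omega> i) = target" "hitting_time target \<omega> = enat (Suc i)"
    unfolding hitting_time_def by blast
  then show "\<exists>i<t. fst (\<omega> i) = target"
    using le by (intro exI[of _ i]) simp
next
  assume "\<exists>i<t. fst (\<omega> i) = target"
  then obtain i where "i < t" "fst (\<omega> i) = target" by auto
  then have "hitting_time target \<omega> \<le> enat (Suc i)"
    unfolding hitting_time_def by (intro Inf_lower) auto
  also have "\<dots> \<le> enat t"
    using \<open>i < t\<close> by simp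
  finally show "hitting_time target \<omega> \<le> enat t" .
qed

lemma sets_hitting_time_le:
  "{\<omega> \<in> space (play_measure p \<sigma> s). hitting_time target \<omega> \<le> enat t} \<in> sets (play_measure p \<sigma> s)"
proof -
  let ?M = "PiM UNIV (\<lambda>_ :: nat. count_space (UNIV :: ('a \<times> 'b) set))"
  have "(\<lambda>\<omega>. \<omega> i) -` {z. fst z = target} \<inter> space ?M \<in> sets ?M" for i
    by (rule measurable_sets[OF measurable_component_singleton]) auto
  then have "(\<Union>i<t. (\<lambda>\<omega>. \<omega> i) -` {z. fst z = target} \<inter> space ?M) \<in> sets ?M"
    by (intro sets.finite_UN) auto
  moreover have "(\<Union>i<t. (\<lambda>\<omega>. \<omega> i) -` {z. fst z = target} \<inter> space ?M)
      = {\<omega> \<in> space (play_measure p \<sigma> s). hitting_time target \<omega> \<le> enat t}"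
    by (auto simp: hitting_time_le_iff space_play_measure space_PiM)
  ultimately show ?thesis
    by (simp add: sets_play_measure)
qed

lemma emeasure_play_C:
  "emeasure (play.C p \<sigma> s 0 n (\<lambda>_. undefined)) {restrict x {0..<n}}
     = (\<Prod>i<n. ennreal (pmf (play_kernel p \<sigma> s i x) (x i)))"
proof (induction n)
  case 0
  then show ?case by (simp add: PiM_empty restrict_def)
next
  case (Suc n)
  let ?M = "\<lambda>n. PiM {0..<n} (\<lambda>_. count_space (UNIV :: ('a \<times> 'b) set))"
  have M: "?M n = count_space (PiE {0..<n} (\<lambda>_. UNIV))" for n :: nat
    by (rule count_space_PiM_finite) auto
  have sing: "{restrict x {0..<n}} \<in> sets (?M n)" for n :: nat
    unfolding M by auto
  have eq: "emeasure (play.eP p \<sigma> s n \<omega>) {restrict x {0..<Suc n}}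
      = ennreal (pmf (play_kernel p \<sigma> s n x) (x n)) * indicator {restrict x {0..<n}} \<omega>"
    if w: "\<omega> \<in> space (?M n)" for \<omega>
  proof -
    have k: "play_kernel p \<sigma> s n (restrict x {0..<n}) = play_kernel p \<sigma> s n x"
    proof -
      have "map (restrict x {0..<n}) [0..<n] = map x [0..<n]"
        by (rule map_cong) auto
      then show ?thesis unfolding play_kernel_def by (simp only:) simp
    qed
    have v: "fun_upd \<omega> n -` {restrict x {0..<Suc n}}
        = (if \<omega> = restrict x {0..<n} then {x n} else {})"
    proof -
      have "fun_upd \<omega> n y = restrict x {0..<Suc n} \<longleftrightarrow> \<omega> = restrict x {0..<n} \<and> y = x n" for y
      proof
        assume eq: "fun_upd \<omega> n y = restrict x {0..<Suc n}"
        have "\<omega> i = restrict x {0..<n} i" for i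
          using fun_cong[OF eq, of i] w
          by (cases "i = n") (auto simp: M PiE_iff extensional_def restrict_def less_Suc_eq)
        moreover have "y = x n"
          using fun_cong[OF eq, of n] by simp
        ultimately show "\<omega> = restrict x {0..<n} \<and> y = x n" by blast
      qed (auto simp: fun_eq_iff restrict_def less_Suc_eq)
      then show ?thesis by (auto simp: vimage_def)
    qed
    show ?thesis
      using w sing[of "Suc n"] by (subst play.emeasure_eP) (auto simp: v k emeasure_pmf_single)
  qed
  have "emeasure (play.C p \<sigma> s 0 (Suc n) (\<lambda>_. undefined)) {restrict x {0..<Suc n}}
      = (\<integral>\<^sup>+\<omega>. emeasure (play.eP p \<sigma> s n \<omega>) {restrict x {0..<Suc n}} \<partial>play.C p \<sigma> s 0 n (\<lambda>_. undefined))"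
    using play.measurable_eP[of p \<sigma> s n] sing[of "Suc n"]
    by (simp, subst emeasure_bind[where N="?M (Suc n)"])
       (auto simp: play.space_C space_PiM measurable_cong_sets[OF play.sets_C refl])
  also have "\<dots> = (\<integral>\<^sup>+\<omega>. ennreal (pmf (play_kernel p \<sigma> s n x) (x n)) * indicator {restrict x {0..<n}} \<omega>
                  \<partial>play.C p \<sigma> s 0 n (\<lambda>_. undefined))"
    by (intro nn_integral_cong eq) (simp add: play.space_C space_PiM)
  also have "\<dots> = ennreal (pmf (play_kernel p \<sigma> s n x) (x n)) *
      emeasure (play.C p \<sigma> s 0 n (\<lambda>_. undefined)) {restrict x {0..<n}}"
    using sing[of n] by (intro nn_integral_cmult_indicator) (simp add: play.sets_C space_PiM)
  finally show ?case
    by (simp only: Suc.IH prod.lessThan_Suc mult.commute)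
qed

lemma emeasure_play_measure_cylinder:
  "emeasure (play_measure p \<sigma> s) {\<omega>. \<forall>i<n. \<omega> i = x i}
     = (\<Prod>i<n. ennreal (pmf (play_kernel p \<sigma> s i x) (x i)))"
proof -
  have M: "PiM {0..<n} (\<lambda>_. count_space (UNIV :: ('a \<times> 'b) set)) = count_space (PiE {0..<n} (\<lambda>_. UNIV))"
    by (rule count_space_PiM_finite) auto
  have sing: "{restrict x {0..<n}} \<in> sets (PiM {0..<n} (\<lambda>_. count_space (UNIV :: ('a \<times> 'b) set)))"
    unfolding M by auto
  have "{\<omega>. \<forall>i<n. \<omega> i = x i} = play.PF.emb UNIV {0..<n} {restrict x {0..<n}}"
    by (auto simp: prod_emb_def space_PiM fun_eq_iff restrict_def) meson
  then have "emeasure (play_measure p \<sigma> s) {\<omega>. \<forall>i<n. \<omega> i = x i} = emeasure (play.CI p \<sigma> s {0..<n}) {restrict x {0..<n}}"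
    using sing by (simp add: play_measure_def play.lim)
  also have "\<dots> = emeasure (play.C p \<sigma> s 0 n (\<lambda>_. undefined)) {restrict x {0..<n}}"
    using sing by (subst play.emeasure_CI[of _ n]) (auto simp: prod_emb_id sets.sets_into_space)
  finally show ?thesis
    by (simp add: emeasure_play_C)
qed

definition reach_prob ::
    "('s :: finite \<Rightarrow> 'a :: finite \<Rightarrow> 's pmf) \<Rightarrow> 's \<Rightarrow> ('s, 'a) strategy \<Rightarrow> 's \<Rightarrow> nat \<Rightarrow> real" where
  "reach_prob p target \<sigma> s t =
     \<P>(\<omega> in play_measure p \<sigma> s. hitting_time target \<omega> \<le> enat t)"

definition weakly_overtakes_at ::
    "('s :: finite \<Rightarrow> 'a :: finite \<Rightarrow> 's pmf) \<Rightarrow> 's \<Rightarrow> ('s, 'a) strategy \<Rightarrow> ('s, 'a) strategy \<Rightarrow> 's \<Rightarrow> bool" where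
  "weakly_overtakes_at p target \<sigma>' \<sigma> s \<longleftrightarrow>
     (\<exists>T. (\<forall>t\<ge>T. reach_prob p target \<sigma>' s t \<ge> reach_prob p target \<sigma> s t)) \<and>
     infinite {t. reach_prob p target \<sigma>' s t > reach_prob p target \<sigma> s t}"

definition deterministic_mdp ::
    "('s \<Rightarrow> 'a set) \<Rightarrow> ('s \<Rightarrow> 'a \<Rightarrow> 's pmf) \<Rightarrow> 's \<Rightarrow> bool" where
  "deterministic_mdp A p target \<longleftrightarrow>
     (\<forall>s a. s \<noteq> target \<longrightarrow> a \<in> A s \<longrightarrow> (\<exists>z. measure_pmf.prob (p s a) {z, target} = 1))"

end

theory Submission
  imports Defs
begin

text \<open>
  Under a pure strategy the play is deterministic until the target is hit, so the probability of not
  having hit it by period \<open>t\<close> is the product of the survival probabilities along a single walk. From a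
  state where some walk has survival probability 0, a shortest such walk is never overtaken. On the
  remaining states, minus the logarithm of the survival probability is a reward on a finite graph,
  and one takes a stationary strategy \<open>f\<close> that is optimal for infinitely many discount factors tending
  to 1. Let \<open>D n\<close> be the \<open>n\<close>-step reward of a walk minus that of \<open>f\<close>. Summation by parts shows that if
  \<open>D\<close> is eventually nonnegative then it cannot exceed a fixed \<open>\<epsilon> > 0\<close> infinitely often. If
  \<open>D\<close> were merely positive infinitely often, then for some two such times \<open>t < u\<close> the pair formed by
  the state of the walk and the state of the play of \<open>f\<close> would be the same; deleting the loop between
  \<open>t\<close> and \<open>u\<close> (if \<open>D u < D t\<close>) or repeating it forever (otherwise) yields a walk that does exceed
  such an \<open>\<epsilon>\<close> infinitely often.
\<close>

section \<open>Stationary policies on a finite graph with rewards\<close>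

locale reward_graph =
  fixes A :: "'s :: finite \<Rightarrow> 'a :: finite set"
    and nxt :: "'s \<Rightarrow> 'a \<Rightarrow> 's"
    and r :: "'s \<Rightarrow> 'a \<Rightarrow> real"
  assumes A_nonempty: "A s \<noteq> {}"
begin

section \<open>Walks and their discounted rewards\<close>

definition walk :: "(nat \<Rightarrow> 's) \<Rightarrow> (nat \<Rightarrow> 'a) \<Rightarrow> bool" where
  "walk x b \<longleftrightarrow> (\<forall>n. b n \<in> A (x n) \<and> x (Suc n) = nxt (x n) (b n))"

definition orbit :: "('s \<Rightarrow> 'a) \<Rightarrow> 's \<Rightarrow> nat \<Rightarrow> 's" where
  "orbit f s n = ((\<lambda>x. nxt x (f x)) ^^ n) s"

definition discounted :: "real \<Rightarrow> (nat \<Rightarrow> 's) \<Rightarrow> (nat \<Rightarrow> 'a) \<Rightarrow> real" where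
  "discounted \<beta> x b = (\<Sum>n. \<beta> ^ n * r (x n) (b n))"

lemma orbit_0 [simp]: "orbit f s 0 = s"
  and orbit_Suc [simp]: "orbit f s (Suc n) = nxt (orbit f s n) (f (orbit f s n))"
  by (simp_all add: orbit_def)

lemma orbit_add: "orbit f s (m + n) = orbit f (orbit f s m) n"
  by (induction n) simp_all

lemma walk_orbit:
  assumes "\<And>s. f s \<in> A s"
  shows "walk (orbit f s) (\<lambda>n. f (orbit f s n))"
  using assms by (simp add: walk_def)

lemma walk_Suc: "walk x b \<Longrightarrow> walk (\<lambda>n. x (Suc n)) (\<lambda>n. b (Suc n))"
  unfolding walk_def by blast

lemma walk_Cons:
  assumes "walk x b" "a \<in> A s" "x 0 = nxt s a"
  shows "walk (case_nat s x) (case_nat a b)"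
  using assms by (auto simp: walk_def split: nat.split)

lemma ex_walk: "\<exists>x b. walk x b \<and> x 0 = s"
proof -
  have "(SOME a. a \<in> A s) \<in> A s" for s
    using A_nonempty some_in_eq by auto
  from walk_orbit[OF this] show ?thesis
    by (intro exI[of _ "orbit (\<lambda>s. SOME a. a \<in> A s) s"]) auto
qed

lemma ex_reward_bound: "\<exists>M. \<forall>s a. \<bar>r s a\<bar> \<le> M"
proof -
  have "\<bar>r s a\<bar> \<le> (\<Sum>s\<in>UNIV. \<Sum>a\<in>UNIV. \<bar>r s a\<bar>)" for s a
  proof -
    have "\<bar>r s a\<bar> \<le> (\<Sum>a\<in>UNIV. \<bar>r s a\<bar>)"
      by (rule member_le_sum) auto
    also have "\<dots> \<le> (\<Sum>s\<in>UNIV. \<Sum>a\<in>UNIV. \<bar>r s a\<bar>)"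
      by (rule member_le_sum[where f="\<lambda>s. \<Sum>a\<in>UNIV. \<bar>r s a\<bar>"]) (auto intro: sum_nonneg)
    finally show ?thesis .
  qed
  then show ?thesis by blast
qed

lemma summable_discounted:
  assumes "0 < \<beta>" "\<beta> < 1"
  shows "summable (\<lambda>n. \<beta> ^ n * r (x n) (b n))"
proof -
  obtain M where M: "\<And>s a. \<bar>r s a\<bar> \<le> M"
    using ex_reward_bound by blast
  show ?thesis
  proof (rule summable_comparison_test')
    show "summable (\<lambda>n. \<beta> ^ n * M)"
      using assms by (intro summable_mult2 summable_geometric) auto
    show "norm (\<beta> ^ n * r (x n) (b n)) \<le> \<beta> ^ n * M" for n
      using assms M by (auto simp: abs_mult intro!: mult_left_mono)
  qed
qed

text \<open>One geometric series dominates all walks at once, so the supremum over walks is finite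
  for each discount factor.\<close>

lemma ex_discounted_bound:
  assumes "0 < \<beta>" "\<beta> < 1"
  shows "\<exists>B. \<forall>x b. \<bar>discounted \<beta> x b\<bar> \<le> B"
proof -
  obtain M where M: "\<And>s a. \<bar>r s a\<bar> \<le> M"
    using ex_reward_bound by blast
  have "\<bar>discounted \<beta> x b\<bar> \<le> (\<Sum>n. \<beta> ^ n * M)" for x b
  proof -
    have "norm (\<Sum>n. \<beta> ^ n * r (x n) (b n)) \<le> (\<Sum>n. \<beta> ^ n * M)"
      using assms M
      by (intro norm_suminf_le summable_mult2 summable_geometric)
         (auto simp: abs_mult intro!: mult_left_mono)
    then show ?thesis
      by (simp add: discounted_def)
  qed
  then show ?thesis by blast
qed

lemma discounted_Suc:
  assumes "0 < \<beta>" "\<beta> < 1"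
  shows "discounted \<beta> x b = r (x 0) (b 0) + \<beta> * discounted \<beta> (\<lambda>n. x (Suc n)) (\<lambda>n. b (Suc n))"
proof -
  have "discounted \<beta> x b = r (x 0) (b 0) + (\<Sum>n. \<beta> ^ Suc n * r (x (Suc n)) (b (Suc n)))"
    unfolding discounted_def
    using suminf_split_head[OF summable_discounted[OF assms, of x b]] by simp
  also have "(\<Sum>n. \<beta> ^ Suc n * r (x (Suc n)) (b (Suc n)))
      = \<beta> * discounted \<beta> (\<lambda>n. x (Suc n)) (\<lambda>n. b (Suc n))"
    unfolding discounted_def
    using suminf_mult[OF summable_discounted[OF assms, of "\<lambda>n. x (Suc n)" "\<lambda>n. b (Suc n)"], of \<beta>]
    by (simp add: mult.assoc)
  finally show ?thesis .
qed

section \<open>The Bellman equation and discount-optimal policies\<close>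

definition opt_value :: "real \<Rightarrow> 's \<Rightarrow> real" where
  "opt_value \<beta> s = (SUP (x, b) \<in> {(x, b). walk x b \<and> x 0 = s}. discounted \<beta> x b)"

lemma discounted_le_opt_value:
  assumes "0 < \<beta>" "\<beta> < 1" "walk x b"
  shows "discounted \<beta> x b \<le> opt_value \<beta> (x 0)"
proof -
  obtain B where "\<And>x b. \<bar>discounted \<beta> x b\<bar> \<le> B"
    using ex_discounted_bound[OF assms(1,2)] by blast
  then have "discounted \<beta> x b \<le> B" for x b
    by (meson abs_le_D1)
  then have "bdd_above ((\<lambda>(x, b). discounted \<beta> x b) ` {(x', b). walk x' b \<and> x' 0 = x 0})"
    by (intro bdd_aboveI[of _ B]) auto
  then show ?thesis
    unfolding opt_value_def using assms(3) by (intro cSUP_upper2[where x="(x, b)"]) auto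
qed

lemma opt_value_le:
  assumes "\<And>x b. walk x b \<Longrightarrow> x 0 = s \<Longrightarrow> discounted \<beta> x b \<le> c"
  shows "opt_value \<beta> s \<le> c"
  unfolding opt_value_def using assms ex_walk[of s] by (intro cSUP_least) auto

text \<open>Prepending \<open>a\<close> to a walk from \<open>nxt s a\<close> gives a walk from
  \<open>s\<close>; dividing by \<open>\<beta>\<close> turns this into an upper bound on every walk
  from \<open>nxt s a\<close>.\<close>

lemma opt_value_ge:
  assumes \<beta>: "0 < \<beta>" "\<beta> < 1" and a: "a \<in> A s"
  shows "r s a + \<beta> * opt_value \<beta> (nxt s a) \<le> opt_value \<beta> s"
proof -
  have "opt_value \<beta> (nxt s a) \<le> (opt_value \<beta> s - r s a) / \<beta>"
  proof (rule opt_value_le)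
    fix x b assume "walk x b" "x 0 = nxt s a"
    then have "discounted \<beta> (case_nat s x) (case_nat a b) \<le> opt_value \<beta> s"
      using discounted_le_opt_value[OF \<beta> walk_Cons[OF _ a]] by simp
    then show "discounted \<beta> x b \<le> (opt_value \<beta> s - r s a) / \<beta>"
      using \<beta> by (simp add: discounted_Suc[OF \<beta>, of "case_nat s x"] field_simps)
  qed
  then show ?thesis
    using \<beta> by (simp add: field_simps)
qed

lemma ex_opt_action:
  assumes \<beta>: "0 < \<beta>" "\<beta> < 1"
  shows "\<exists>a\<in>A s. opt_value \<beta> s = r s a + \<beta> * opt_value \<beta> (nxt s a)"
proof -
  let ?Q = "\<lambda>a. r s a + \<beta> * opt_value \<beta> (nxt s a)"
  obtain a where a: "a \<in> A s" and Q: "Max (?Q ` A s) = ?Q a"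
    using obtains_MAX[of "A s" ?Q] A_nonempty[of s] by auto
  have max: "?Q a' \<le> ?Q a" if "a' \<in> A s" for a'
    unfolding Q[symmetric] using that by (intro Max_ge) auto
  have "opt_value \<beta> s \<le> ?Q a"
  proof (rule opt_value_le)
    fix x b assume w: "walk x b" and s: "x 0 = s"
    have "discounted \<beta> x b = r s (b 0) + \<beta> * discounted \<beta> (\<lambda>n. x (Suc n)) (\<lambda>n. b (Suc n))"
      using discounted_Suc[OF \<beta>, of x b] s by simp
    also have "\<dots> \<le> ?Q (b 0)"
      using discounted_le_opt_value[OF \<beta> walk_Suc[OF w]] w s \<beta> by (auto simp: walk_def)
    also have "\<dots> \<le> ?Q a"
      using w s by (intro max) (auto simp: walk_def)
    finally show "discounted \<beta> x b \<le> ?Q a" .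
  qed
  then show ?thesis
    using opt_value_ge[OF \<beta> a] a by (intro bexI[of _ a]) auto
qed

text \<open>Choosing a Bellman-optimal action in each state gives one policy that is optimal from
  all initial states: its reward telescopes to the optimal value.\<close>

lemma ex_discount_optimal:
  assumes \<beta>: "0 < \<beta>" "\<beta> < 1"
  shows "\<exists>f. (\<forall>s. f s \<in> A s) \<and>
    (\<forall>x b. walk x b \<longrightarrow>
       discounted \<beta> x b \<le> discounted \<beta> (orbit f (x 0)) (\<lambda>n. f (orbit f (x 0) n)))"
proof -
  obtain f where f: "\<And>s. f s \<in> A s"
    and V: "\<And>s. opt_value \<beta> s = r s (f s) + \<beta> * opt_value \<beta> (nxt s (f s))"
    using ex_opt_action[OF \<beta>] by metis
  have "discounted \<beta> (orbit f s) (\<lambda>n. f (orbit f s n)) = opt_value \<beta> s" for s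
  proof -
    let ?R = "\<lambda>n. \<beta> ^ n * r (orbit f s n) (f (orbit f s n))"
    have part: "(\<Sum>i<n. ?R i) = opt_value \<beta> s - \<beta> ^ n * opt_value \<beta> (orbit f s n)" for n
      by (induction n) (simp_all add: V[of "orbit f s _"] algebra_simps)
    \<comment> \<open>The remainder of the telescoping sum vanishes because the optimal value takes
      only finitely many values.\<close>
    have "(\<lambda>n. \<beta> ^ n * opt_value \<beta> (orbit f s n)) \<longlonglongrightarrow> 0"
    proof (rule Lim_null_comparison)
      let ?M = "Max (range (\<lambda>s. \<bar>opt_value \<beta> s\<bar>))"
      show "\<forall>\<^sub>F n in sequentially. norm (\<beta> ^ n * opt_value \<beta> (orbit f s n)) \<le> \<beta> ^ n * ?M"
        using \<beta> by (auto simp: abs_mult intro!: mult_left_mono always_eventually)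
      show "(\<lambda>n. \<beta> ^ n * ?M) \<longlonglongrightarrow> 0"
        using \<beta> by (intro tendsto_mult_left_zero LIMSEQ_power_zero) auto
    qed
    then have "(\<lambda>n. \<Sum>i<n. ?R i) \<longlonglongrightarrow> opt_value \<beta> s - 0"
      unfolding part by (intro tendsto_intros)
    then have "?R sums opt_value \<beta> s"
      by (simp add: sums_def)
    then show ?thesis
      unfolding discounted_def by (rule sums_unique[symmetric])
  qed
  with f show ?thesis
    using discounted_le_opt_value[OF \<beta>] by (intro exI[of _ f]) auto
qed

end

section \<open>Summation by parts for discounted series\<close>

lemma discounted_sum_by_parts:
  fixes \<beta> :: real
  shows "(\<Sum>t<n. \<beta> ^ t * d t)
    = \<beta> ^ n * (\<Sum>i<n. d i) + (1 - \<beta>) * (\<Sum>t<n. \<beta> ^ t * (\<Sum>i<Suc t. d i))"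
proof (induction n)
  case (Suc n)
  show ?case
    by (simp only: sum.lessThan_Suc[of _ n] Suc.IH) (simp add: algebra_simps)
qed simp

text \<open>After summation by parts up to \<open>N \<ge> n\<close>, the boundary term and all terms
  from \<open>n\<close> on are nonnegative, so \<open>(1 - \<beta>)\<close> times the sum up to
  \<open>n\<close> is below the limit of the series. The resulting bound is on a finite sum, in
  which \<open>\<beta>\<close> can later tend to 1.\<close>

lemma Abel_sum_nonpos:
  fixes d :: "nat \<Rightarrow> real"
  assumes \<beta>: "0 < \<beta>" "\<beta> < 1"
    and summable: "summable (\<lambda>t. \<beta> ^ t * d t)" and nonpos: "(\<Sum>t. \<beta> ^ t * d t) \<le> 0"
    and ge: "\<And>n. n \<ge> T \<Longrightarrow> (\<Sum>i<n. d i) \<ge> 0" and n: "n \<ge> T"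
  shows "(\<Sum>t<n. \<beta> ^ t * (\<Sum>i<Suc t. d i)) \<le> 0"
proof -
  let ?G = "\<lambda>n. \<Sum>t<n. \<beta> ^ t * (\<Sum>i<Suc t. d i)"
  have "(1 - \<beta>) * ?G n \<le> (\<Sum>t<N. \<beta> ^ t * d t)" if "N \<ge> n" for N
  proof -
    have "?G n \<le> ?G N"
      using that n \<beta> by (intro sum_mono2) (auto intro!: mult_nonneg_nonneg ge simp del: sum.lessThan_Suc)
    then have "(1 - \<beta>) * ?G n \<le> (1 - \<beta>) * ?G N"
      using \<beta> by (intro mult_left_mono) auto
    also have "\<dots> \<le> (\<Sum>t<N. \<beta> ^ t * d t)"
      unfolding discounted_sum_by_parts[of \<beta> d N] using that n \<beta> ge[of N] by simp
    finally show ?thesis .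
  qed
  then have "(1 - \<beta>) * ?G n \<le> (\<Sum>t. \<beta> ^ t * d t)"
    using LIMSEQ_le_const[OF summable_LIMSEQ[OF summable]] by blast
  with nonpos have "(1 - \<beta>) * ?G n \<le> 0"
    by linarith
  then show ?thesis
    using \<beta> by (simp add: mult_le_0_iff)
qed

text \<open>Otherwise the nonnegative tail would be summable and \<open>D\<close> would tend to 0,
  so it would exceed \<open>\<epsilon>\<close> only finitely often.\<close>

lemma partial_sums_not_bounded:
  fixes D :: "nat \<Rightarrow> real"
  assumes ge: "\<And>n. n \<ge> T \<Longrightarrow> D n \<ge> 0" and \<epsilon>: "\<epsilon> > 0" "infinite {n. D n \<ge> \<epsilon>}"
  shows "\<exists>n\<ge>T. (\<Sum>t<n. D t) > c"
proof (rule ccontr)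
  assume "\<not> ?thesis"
  then have le: "n \<ge> T \<Longrightarrow> (\<Sum>t<n. D t) \<le> c" for n
    by force
  have "summable (\<lambda>n. D (n + T))"
  proof (rule summableI_nonneg_bounded)
    show "0 \<le> D (n + T)" for n
      by (simp add: ge)
    show "(\<Sum>t<n. D (t + T)) \<le> c - (\<Sum>t<T. D t)" for n
    proof -
      have "(\<Sum>t<n + T. D t) = (\<Sum>t<T. D t) + (\<Sum>t<n. D (t + T))"
        by (induction n) auto
      then show ?thesis
        using le[of "n + T"] by simp
    qed
  qed
  then have "D \<longlonglongrightarrow> 0"
    by (rule LIMSEQ_offset[OF summable_LIMSEQ_zero])
  then have "\<forall>\<^sub>F n in sequentially. D n < \<epsilon>"
    using \<epsilon>(1) by (rule order_tendstoD)
  then have "finite {n. \<not> D n < \<epsilon>}"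
    by (simp add: cofinite_eq_sequentially[symmetric] eventually_cofinite)
  with \<epsilon>(2) show False
    by (simp add: not_less)
qed

section \<open>From discounted optimality to not being overtaken\<close>

context reward_graph
begin

text \<open>The partial sums of \<open>gap\<close> are the sequence \<open>D\<close> of the
  overview; both plays start in \<open>x 0\<close>.\<close>

definition gap :: "('s \<Rightarrow> 'a) \<Rightarrow> (nat \<Rightarrow> 's) \<Rightarrow> (nat \<Rightarrow> 'a) \<Rightarrow> nat \<Rightarrow> real" where
  "gap f x b i = r (x i) (b i) - r (orbit f (x 0) i) (f (orbit f (x 0) i))"

lemma ex_Cesaro_optimal:
  "\<exists>f. (\<forall>s. f s \<in> A s) \<and>
    (\<forall>x b T n. walk x b \<longrightarrow> (\<forall>n\<ge>T. (\<Sum>i<n. gap f x b i) \<ge> 0) \<longrightarrow> n \<ge> T \<longrightarrow>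
       (\<Sum>t<n. \<Sum>i<Suc t. gap f x b i) \<le> 0)"
proof -
  \<comment> \<open>The shift by two keeps \<open>\<beta> 0 = 1/2\<close> inside the open unit
    interval.\<close>
  define \<beta> :: "nat \<Rightarrow> real" where "\<beta> k = 1 - inverse (real (Suc (Suc k)))" for k
  have \<beta>: "0 < \<beta> k" "\<beta> k < 1" for k
    by (auto simp: \<beta>_def field_simps)
  have \<beta>_lim: "\<beta> \<longlonglongrightarrow> 1"
    unfolding \<beta>_def
    using tendsto_diff[OF tendsto_const LIMSEQ_Suc[OF LIMSEQ_inverse_real_of_nat], of 1] by simp
  obtain F where F: "\<And>k s. F k s \<in> A s"
    and opt: "\<And>k x b. walk x b \<Longrightarrow>
      discounted (\<beta> k) x b \<le> discounted (\<beta> k) (orbit (F k) (x 0)) (\<lambda>n. F k (orbit (F k) (x 0) n))"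
    using ex_discount_optimal[OF \<beta>] by metis
  \<comment> \<open>There are only finitely many policies, so one of them is optimal for infinitely
    many of the discount factors.\<close>
  have "\<exists>k0. infinite {k \<in> UNIV. F k = F k0}"
    using pigeonhole_infinite[of "UNIV :: nat set" F] by auto
  then obtain f where inf: "infinite {k. F k = f}"
    by auto
  then obtain k0 where "F k0 = f"
    using infinite_imp_nonempty by blast
  with F have f: "\<forall>s. f s \<in> A s"
    by auto
  have "(\<Sum>t<n. \<Sum>i<Suc t. gap f x b i) \<le> 0"
    if w: "walk x b" and ge: "\<forall>n\<ge>T. (\<Sum>i<n. gap f x b i) \<ge> 0" and n: "n \<ge> T" for x b T n
  proof (rule ccontr)
    let ?G = "\<lambda>\<beta>. \<Sum>t<n. \<beta> ^ t * (\<Sum>i<Suc t. gap f x b i)"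
    assume "\<not> ?thesis"
    then have pos: "0 < ?G 1"
      by simp
    \<comment> \<open>\<open>?G\<close> is a polynomial in its argument: if positive at 1, it is
      positive at all but finitely many \<open>\<beta> k\<close>, whereas optimality of
      \<open>f\<close> makes it nonpositive at infinitely many.\<close>
    have "(\<lambda>k. ?G (\<beta> k)) \<longlonglongrightarrow> ?G 1"
      by (intro tendsto_intros \<beta>_lim)
    then have "\<forall>\<^sub>F k in sequentially. 0 < ?G (\<beta> k)"
      using pos by (rule order_tendstoD)
    then have "finite {k. \<not> 0 < ?G (\<beta> k)}"
      by (simp only: cofinite_eq_sequentially[symmetric] eventually_cofinite)
    moreover have "\<not> 0 < ?G (\<beta> k)" if k: "F k = f" for k
    proof -
      let ?y = "orbit f (x 0)"
      have sm: "summable (\<lambda>n. \<beta> k ^ n * r (x n) (b n))"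
        "summable (\<lambda>n. \<beta> k ^ n * r (?y n) (f (?y n)))"
        by (rule summable_discounted[OF \<beta>])+
      have "summable (\<lambda>t. \<beta> k ^ t * gap f x b t)"
        using summable_diff[OF sm] by (simp add: gap_def right_diff_distrib)
      moreover have "(\<Sum>t. \<beta> k ^ t * gap f x b t) \<le> 0"
        using suminf_diff[OF sm] opt[OF w, of k] k
        by (simp add: gap_def right_diff_distrib discounted_def)
      ultimately have "?G (\<beta> k) \<le> 0"
        using ge n by (intro Abel_sum_nonpos[OF \<beta>, where T=T]) auto
      then show ?thesis by simp
    qed
    ultimately show False
      using inf by (metis (mono_tags, lifting) Collect_mono finite_subset)
  qed
  with f show ?thesis by blast
qed

text \<open>The policy is the one from \<open>ex_Cesaro_optimal\<close>. That bound excludes only a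
  lead of fixed size recurring infinitely often (\<open>no_gain\<close>); a lead that shrinks to 0
  is excluded by surgery on loops.\<close>

lemma ex_not_overtaken:
  "\<exists>f. (\<forall>s. f s \<in> A s) \<and>
    (\<forall>x b T. walk x b \<longrightarrow> (\<forall>n\<ge>T. (\<Sum>i<n. gap f x b i) \<ge> 0) \<longrightarrow>
       finite {n. (\<Sum>i<n. gap f x b i) > 0})"
proof -
  obtain f where f: "\<And>s. f s \<in> A s"
    and cesaro: "\<And>x b T n. walk x b \<Longrightarrow> (\<And>n. n \<ge> T \<Longrightarrow> (\<Sum>i<n. gap f x b i) \<ge> 0) \<Longrightarrow> n \<ge> T \<Longrightarrow>
       (\<Sum>t<n. \<Sum>i<Suc t. gap f x b i) \<le> 0"
    using ex_Cesaro_optimal by metis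
  have no_gain: "finite {n. (\<Sum>i<n. gap f x b i) \<ge> \<epsilon>}"
    if w: "walk x b" and ge: "\<And>n. n \<ge> T \<Longrightarrow> (\<Sum>i<n. gap f x b i) \<ge> 0" and \<epsilon>: "\<epsilon> > 0"
    for x b T \<epsilon>
  proof (rule ccontr)
    let ?D = "\<lambda>n. \<Sum>i<n. gap f x b i"
    assume inf: "infinite {n. ?D n \<ge> \<epsilon>}"
    obtain n where n: "n \<ge> T" "(\<Sum>t<n. ?D t) > 0"
      using partial_sums_not_bounded[of T ?D \<epsilon> 0] ge \<epsilon> inf by blast
    \<comment> \<open>\<open>cesaro\<close> bounds the sum of \<open>?D (Suc t)\<close>. The shift
      costs nothing since \<open>?D 0 = 0\<close> and \<open>?D n \<ge> 0\<close>.\<close>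
    have "(\<Sum>t<n. ?D t) \<le> (\<Sum>t<Suc n. ?D t)"
      using ge[OF n(1)] by simp
    also have "\<dots> = (\<Sum>t<n. ?D (Suc t))"
      by (subst sum.lessThan_Suc_shift) simp
    finally show False
      using cesaro[OF w ge n(1)] n(2) by simp
  qed
  have "finite {n. (\<Sum>i<n. gap f x b i) > 0}"
    if w: "walk x b" and ge: "\<And>n. n \<ge> T \<Longrightarrow> (\<Sum>i<n. gap f x b i) \<ge> 0" for x b T
  proof (rule ccontr)
    let ?D = "\<lambda>n. \<Sum>i<n. gap f x b i"
    let ?y = "orbit f (x 0)"
    assume "infinite {n. ?D n > 0}"
    then have "infinite ({n. ?D n > 0} - {..<T})"
      by (rule Diff_infinite_finite[rotated]) simp
    \<comment> \<open>Recurrence of the pair, not just of \<open>x\<close>, is needed so that walk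
      and policy play can be rerouted at the same times.\<close>
    moreover have "finite ((\<lambda>n. (x n, ?y n)) ` ({n. ?D n > 0} - {..<T}))"
      by simp
    ultimately have "\<not> inj_on (\<lambda>n. (x n, ?y n)) ({n. ?D n > 0} - {..<T})"
      using finite_imageD by blast
    then obtain t u where "t \<noteq> u" "t \<ge> T" "?D t > 0" "u \<ge> T" "?D u > 0" "x t = x u" "?y t = ?y u"
      unfolding inj_on_def by (metis (no_types, lifting) Diff_iff Pair_inject lessThan_iff mem_Collect_eq not_less)
    then obtain t u where tu: "t < u" "t \<ge> T" "?D t > 0" "x t = x u" "?y t = ?y u"
      by (metis linorder_neqE_nat)
    \<comment> \<open>A change of time \<open>\<phi>\<close> that jumps only between times with
      equal pairs yields a walk again. It leaves the play of \<open>f\<close> unchanged, since that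
      play is determined by its current state, so the gaps are the old ones read at time
      \<open>\<phi> i\<close>.\<close>
    have reindexed: "walk (\<lambda>n. x (\<phi> n)) (\<lambda>n. b (\<phi> n))" "gap f (\<lambda>n. x (\<phi> n)) (\<lambda>n. b (\<phi> n)) i = gap f x b (\<phi> i)"
      if 0: "x (\<phi> 0) = x 0" and Suc: "\<And>n. x (\<phi> (Suc n)) = x (Suc (\<phi> n))"
        "\<And>n. ?y (\<phi> (Suc n)) = ?y (Suc (\<phi> n))" and y0: "?y (\<phi> 0) = ?y 0" for \<phi> :: "nat \<Rightarrow> nat" and i
    proof -
      show "walk (\<lambda>n. x (\<phi> n)) (\<lambda>n. b (\<phi> n))"
        using w Suc(1) by (auto simp: walk_def)
      have "?y (\<phi> i) = ?y i"
        by (induction i) (use y0 Suc(2) in auto)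
      then show "gap f (\<lambda>n. x (\<phi> n)) (\<lambda>n. b (\<phi> n)) i = gap f x b (\<phi> i)"
        using 0 by (simp add: gap_def)
    qed
    show False
    proof (cases "?D u < ?D t")
      case True
      \<comment> \<open>Cutting the losing loop out of the walk keeps it ahead by a constant.\<close>
      define \<phi> where "\<phi> n = (if n < t then n else n + (u - t))" for n
      have x0: "x (\<phi> 0) = x 0" "?y (\<phi> 0) = ?y 0"
        using tu by (auto simp: \<phi>_def)
      have "\<phi> (Suc n) = Suc (\<phi> n) \<or> (Suc (\<phi> n) = t \<and> \<phi> (Suc n) = u)" for n
        using tu by (auto simp: \<phi>_def)
      then have Suc: "x (\<phi> (Suc n)) = x (Suc (\<phi> n))" "?y (\<phi> (Suc n)) = ?y (Suc (\<phi> n))" for n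
        using tu(4,5) by metis+
      note re = reindexed[OF x0(1) Suc x0(2)]
      \<comment> \<open>Deletion removes the loop's contribution \<open>?D u - ?D t\<close>, which
        is negative here.\<close>
      have "(\<Sum>i<n. gap f (\<lambda>n. x (\<phi> n)) (\<lambda>n. b (\<phi> n)) i) = ?D (n + (u - t)) + (?D t - ?D u)" if "n \<ge> t" for n
        using that
      proof (induction n rule: dec_induct)
        case base
        have "(\<Sum>i<t. gap f x b (\<phi> i)) = ?D t"
          by (rule sum.cong) (auto simp: \<phi>_def)
        then show ?case
          using tu by (simp add: re(2))
      next
        case (step n)
        from step(1) have "\<phi> n = n + (u - t)"
          by (simp add: \<phi>_def)
        with step(3) show ?case
          by (simp add: re(2))
      qed
      then have ahead: "(\<Sum>i<n. gap f (\<lambda>n. x (\<phi> n)) (\<lambda>n. b (\<phi> n)) i) \<ge> ?D t - ?D u" if "n \<ge> t" for n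
        using that ge[of "n + (u - t)"] tu by simp
      have "finite {n. (\<Sum>i<n. gap f (\<lambda>n. x (\<phi> n)) (\<lambda>n. b (\<phi> n)) i) \<ge> ?D t - ?D u}"
      proof (rule no_gain[OF re(1), of t])
        show "(\<Sum>i<n. gap f (\<lambda>n. x (\<phi> n)) (\<lambda>n. b (\<phi> n)) i) \<ge> 0" if "n \<ge> t" for n
          using ahead[OF that] True by linarith
      qed (use True in simp)
      moreover have "{t..} \<subseteq> {n. (\<Sum>i<n. gap f (\<lambda>n. x (\<phi> n)) (\<lambda>n. b (\<phi> n)) i) \<ge> ?D t - ?D u}"
        using ahead by auto
      ultimately show False
        using finite_subset infinite_Ici by blast
    next
      case False
      \<comment> \<open>Repeating the loop forever keeps the walk ahead by \<open>?D t\<close> infinitely often.\<close>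
      define \<phi> where "\<phi> n = (if n < t then n else t + (n - t) mod (u - t))" for n
      have x0: "x (\<phi> 0) = x 0" "?y (\<phi> 0) = ?y 0"
        using tu by (auto simp: \<phi>_def)
      have \<phi>_Suc: "\<phi> (Suc n) = Suc (\<phi> n) \<or> (n \<ge> t \<and> Suc (\<phi> n) = u \<and> \<phi> (Suc n) = t)" for n
        using tu by (auto simp: \<phi>_def Suc_diff_le mod_Suc)
      then have Suc: "x (\<phi> (Suc n)) = x (Suc (\<phi> n))" "?y (\<phi> (Suc n)) = ?y (Suc (\<phi> n))" for n
        using tu(4,5) by metis+
      note re = reindexed[OF x0(1) Suc x0(2)]
      \<comment> \<open>Equality holds up to the first return; each closing of the loop then adds
        \<open>?D u - ?D t \<ge> 0\<close>, which \<open>?D (\<phi> n)\<close> does not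
        record.\<close>
      have ahead: "(\<Sum>i<n. gap f (\<lambda>n. x (\<phi> n)) (\<lambda>n. b (\<phi> n)) i) \<ge> ?D (\<phi> n)" if "n \<ge> t" for n
        using that
      proof (induction n rule: dec_induct)
        case base
        have "(\<Sum>i<t. gap f x b (\<phi> i)) = ?D t"
          by (rule sum.cong) (auto simp: \<phi>_def)
        moreover have "\<phi> t = t"
          by (simp add: \<phi>_def)
        ultimately show ?case
          by (simp add: re(2))
      next
        case (step n)
        have "?D (\<phi> (Suc n)) \<le> ?D (Suc (\<phi> n))"
          using \<phi>_Suc[of n] False by (metis not_less order_refl)
        then show ?case
          using step by (simp add: re(2))
      qed
      have "finite {n. (\<Sum>i<n. gap f (\<lambda>n. x (\<phi> n)) (\<lambda>n. b (\<phi> n)) i) \<ge> ?D t}"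
      proof (rule no_gain[OF re(1), of t])
        fix n assume "n \<ge> t"
        moreover from this have "\<phi> n \<ge> T"
          using tu(2) by (simp add: \<phi>_def)
        ultimately show "(\<Sum>i<n. gap f (\<lambda>n. x (\<phi> n)) (\<lambda>n. b (\<phi> n)) i) \<ge> 0"
          using ahead ge order_trans by blast
      qed (use tu in auto)
      \<comment> \<open>At these times the loop restarts, \<open>\<phi>\<close> equals
        \<open>t\<close>, and the lead is at least \<open>?D t\<close>.\<close>
      moreover have "range (\<lambda>k. t + k * (u - t)) \<subseteq> {n. (\<Sum>i<n. gap f (\<lambda>n. x (\<phi> n)) (\<lambda>n. b (\<phi> n)) i) \<ge> ?D t}"
      proof -
        have "\<phi> (t + k * (u - t)) = t" for k
          by (simp add: \<phi>_def)
        then show ?thesis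
          using ahead[of "t + k * (u - t)" for k] by auto
      qed
      moreover have "infinite (range (\<lambda>k. t + k * (u - t)))"
        using tu by (intro range_inj_infinite injI) auto
      ultimately show False
        using finite_subset by blast
    qed
  qed
  with f show ?thesis by blast
qed

end

section \<open>The hitting time under a pure strategy\<close>

definition survival :: "('s \<Rightarrow> 'a \<Rightarrow> 's pmf) \<Rightarrow> 's \<Rightarrow> 's \<Rightarrow> 'a \<Rightarrow> real" where
  "survival p target s a = 1 - pmf (p s a) target"

text \<open>If \<open>survival p target s a = 0\<close>, then \<open>successor p target s a\<close> is an arbitrary state.\<close>

definition successor :: "('s \<Rightarrow> 'a \<Rightarrow> 's pmf) \<Rightarrow> 's \<Rightarrow> 's \<Rightarrow> 'a \<Rightarrow> 's" where
  "successor p target s a = (SOME z. measure_pmf.prob (p s a) {z, target} = 1)"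

lemma survival_nonneg: "0 \<le> survival p target s a"
  by (simp add: survival_def pmf_le_1)

text \<open>The witness of determinism carries all mass together with the target. If it were the
  target itself, survival would be 0; otherwise its mass is the complement of the target's.\<close>

lemma
  assumes "deterministic_mdp A p target" "s \<noteq> target" "a \<in> A s"
  shows set_pmf_subset_successor: "set_pmf (p s a) \<subseteq> {successor p target s a, target}"
    and survival_pos_imp: "0 < survival p target s a \<Longrightarrow>
      successor p target s a \<noteq> target \<and> pmf (p s a) (successor p target s a) = survival p target s a"
proof -
  let ?z = "successor p target s a"
  have 1: "measure_pmf.prob (p s a) {?z, target} = 1"
  proof -
    have "\<exists>z. measure_pmf.prob (p s a) {z, target} = 1"
      using assms unfolding deterministic_mdp_def by blast
    then show ?thesis
      unfolding successor_def by (rule someI_ex)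
  qed
  then show "set_pmf (p s a) \<subseteq> {?z, target}"
    using measure_pmf.prob_eq_1[of "{?z, target}" "p s a"] by (simp add: AE_measure_pmf_iff subset_iff)
  assume pos: "0 < survival p target s a"
  have z: "?z \<noteq> target"
  proof
    assume "?z = target"
    with 1 have "pmf (p s a) target = 1"
      by (simp add: pmf.rep_eq)
    with pos show False
      by (simp add: survival_def)
  qed
  have "measure_pmf.prob (p s a) {?z, target} = pmf (p s a) ?z + pmf (p s a) target"
    using z by (subst measure_measure_pmf_finite) auto
  with 1 z show "?z \<noteq> target \<and> pmf (p s a) ?z = survival p target s a"
    by (simp add: survival_def)
qed

lemma survival_pos_of_pmf_pos:
  assumes "pmf (p s a) z > 0" "z \<noteq> target"
  shows "survival p target s a > 0"
proof -
  have "pmf (p s a) z + pmf (p s a) target = measure_pmf.prob (p s a) {z, target}"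
    using assms(2) by (subst measure_measure_pmf_finite) auto
  also have "\<dots> \<le> 1"
    by (rule measure_pmf.prob_le_1)
  finally show ?thesis
    using assms(1) by (simp add: survival_def)
qed

lemma pmf_eq_1_imp_return_pmf:
  assumes "pmf M a = 1"
  shows "M = return_pmf a"
proof -
  have "measure_pmf.prob M {a} = 1"
    using assms by (simp add: pmf.rep_eq)
  then have "set_pmf M \<subseteq> {a}"
    using measure_pmf.prob_eq_1[of "{a}" M] by (simp add: AE_measure_pmf_iff subset_iff)
  then show ?thesis
    by (simp add: set_pmf_subset_singleton)
qed

section \<open>Probabilities of finite prefixes of the play\<close>

lemma pmf_play_kernel:
  "pmf (play_kernel p \<sigma> s i w) (z, a)
    = pmf (if i = 0 then return_pmf s else p (fst (w (i - 1))) (snd (w (i - 1)))) z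
      * pmf (\<sigma> (map w [0..<i], z)) a"
proof -
  let ?M = "if i = 0 then return_pmf s else p (fst (w (i - 1))) (snd (w (i - 1)))"
  have inner: "pmf (map_pmf (Pair y) N) (z, a) = indicator {z} y * pmf N a" for y and N :: "'b pmf"
  proof (cases "y = z")
    case True
    then show ?thesis
      using pmf_map_inj'[of "Pair z" N a] by (simp add: inj_def)
  next
    case False
    then show ?thesis
      by (subst pmf_map_outside) auto
  qed
  have "pmf (play_kernel p \<sigma> s i w) (z, a)
      = (\<integral>y. indicator {z} y * pmf (\<sigma> (map w [0..<i], z)) a \<partial>measure_pmf ?M)"
    unfolding play_kernel_def pmf_bind inner
    by (rule integral_cong_AE) (auto simp: indicator_def)
  also have "\<dots> = pmf ?M z * pmf (\<sigma> (map w [0..<i], z)) a"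
    by (simp add: pmf.rep_eq)
  finally show ?thesis .
qed

lemma measure_play_cylinder:
  "measure (play_measure p \<sigma> s) {\<omega>. \<forall>i<n. \<omega> i = w i} = (\<Prod>i<n. pmf (play_kernel p \<sigma> s i w) (w i))"
  using emeasure_play_measure_cylinder[of p \<sigma> s n w]
  by (simp add: measure_def prod_ennreal prod_nonneg)

lemma cylinder_in_sets: "{\<omega>. \<forall>i<n. \<omega> i = w i} \<in> sets (play_measure p \<sigma> s)"
proof -
  have "(\<lambda>\<omega>. \<omega> i) \<in> measurable (play_measure p \<sigma> s) (count_space UNIV)" for i :: nat
    by (simp add: measurable_cong_sets[OF sets_play_measure refl])
  then have "{\<omega> \<in> space (play_measure p \<sigma> s). \<forall>i<n. \<omega> i = w i} \<in> sets (play_measure p \<sigma> s)"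
    by measurable
  then show ?thesis
    by (simp add: space_play_measure)
qed

text \<open>The unique play that a pure strategy can produce before the target is hit.\<close>

primrec surviving_play ::
    "('s \<Rightarrow> 'a \<Rightarrow> 's pmf) \<Rightarrow> 's \<Rightarrow> ('s, 'a) strategy \<Rightarrow> 's \<Rightarrow> nat \<Rightarrow> ('s, 'a) history" where
  "surviving_play p target \<sigma> s 0 = ([], s)"
| "surviving_play p target \<sigma> s (Suc n) =
     (let h = surviving_play p target \<sigma> s n; x = final_state h; a = (SOME a. pmf (\<sigma> h) a = 1)
      in (fst h @ [(x, a)], successor p target x a))"

section \<open>The surviving play and the law of the hitting time\<close>

context
  fixes A :: "'s :: finite \<Rightarrow> 'a :: finite set"
    and p :: "'s \<Rightarrow> 'a \<Rightarrow> 's pmf"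
    and target :: 's
    and \<sigma> :: "('s, 'a) strategy"
    and s :: 's
begin

definition play_state :: "nat \<Rightarrow> 's" where
  "play_state n = final_state (surviving_play p target \<sigma> s n)"

definition play_action :: "nat \<Rightarrow> 'a" where
  "play_action n = (SOME a. pmf (\<sigma> (surviving_play p target \<sigma> s n)) a = 1)"

lemma play_state_0 [simp]: "play_state 0 = s"
  by (simp add: play_state_def)

lemma play_state_Suc: "play_state (Suc n) = successor p target (play_state n) (play_action n)"
  by (simp add: play_state_def play_action_def Let_def)

lemma surviving_play_eq:
  "surviving_play p target \<sigma> s n = (map (\<lambda>i. (play_state i, play_action i)) [0..<n], play_state n)"
  by (induction n) (simp_all add: Let_def play_state_Suc, simp_all add: play_action_def)

abbreviation play_survival :: "nat \<Rightarrow> real" where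
  "play_survival n \<equiv> survival p target (play_state n) (play_action n)"

lemma history_surviving_play_iff:
  "is_history A p target (surviving_play p target \<sigma> s n) \<longleftrightarrow>
    s \<noteq> target \<and>
    (\<forall>i<n. play_action i \<in> A (play_state i) \<and>
       pmf (p (play_state i) (play_action i)) (play_state (Suc i)) > 0)"
proof -
  have "history_states (surviving_play p target \<sigma> s n) = map play_state [0..<Suc n]"
    by (simp add: history_states_def surviving_play_eq)
  then have "history_states (surviving_play p target \<sigma> s n) ! i = play_state i" if "i \<le> n" for i
    using that by (simp del: upt_Suc)
  then show ?thesis
    unfolding is_history_def by (auto simp: surviving_play_eq Let_def)
qed

context
  assumes det: "deterministic_mdp A p target"
    and strategy: "is_strategy A p target \<sigma>"
    and pure: "is_pure A p target \<sigma>"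
    and start: "s \<noteq> target"
begin

text \<open>Purity and admissibility constrain \<open>\<sigma>\<close> on genuine histories only,
  hence the hypothesis.\<close>

lemma strategy_surviving_play:
  assumes "is_history A p target (surviving_play p target \<sigma> s n)"
  shows "\<sigma> (surviving_play p target \<sigma> s n) = return_pmf (play_action n)"
    and "play_action n \<in> A (play_state n)"
proof -
  have "\<exists>a. pmf (\<sigma> (surviving_play p target \<sigma> s n)) a = 1"
    using assms pure unfolding is_pure_def by blast
  then have "pmf (\<sigma> (surviving_play p target \<sigma> s n)) (play_action n) = 1"
    unfolding play_action_def by (rule someI_ex)
  then show eq: "\<sigma> (surviving_play p target \<sigma> s n) = return_pmf (play_action n)"
    by (rule pmf_eq_1_imp_return_pmf)
  have "set_pmf (\<sigma> (surviving_play p target \<sigma> s n)) \<subseteq> A (play_state n)"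
    using assms strategy unfolding is_strategy_def play_state_def by blast
  then show "play_action n \<in> A (play_state n)"
    by (simp add: eq)
qed

text \<open>Both claims go through one induction: determinism applies only at states other than the
  target, and positive survival passes this on to the successor.\<close>

lemma surviving_play_valid:
  assumes "\<And>i. i < n \<Longrightarrow> play_survival i > 0"
  shows "is_history A p target (surviving_play p target \<sigma> s n) \<and> play_state n \<noteq> target"
  using assms
proof (induction n)
  case 0
  then show ?case
    using start by (simp add: history_surviving_play_iff del: surviving_play.simps)
next
  case (Suc n)
  then have IH: "is_history A p target (surviving_play p target \<sigma> s n)" "play_state n \<noteq> target"
    by auto
  note a = strategy_surviving_play(2)[OF IH(1)]
  have "play_state (Suc n) \<noteq> target
      \<and> pmf (p (play_state n) (play_action n)) (play_state (Suc n)) = play_survival n"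
    unfolding play_state_Suc using Suc.prems[of n] by (intro survival_pos_imp[OF det IH(2) a]) simp
  with IH a Suc.prems[of n] show ?case
    by (simp add: history_surviving_play_iff less_Suc_eq del: surviving_play.simps)
qed

text \<open>Each step is forced: off the target, the only possible next state is the successor, and
  a pure strategy allows one action. Survival is obtained only below \<open>n - 1\<close>, because
  the transition out of the last state is not observed.\<close>

lemma surviving_play_unique:
  assumes "\<And>i. i < n \<Longrightarrow> fst (w i) \<noteq> target"
    and "\<And>i. i < n \<Longrightarrow> pmf (play_kernel p \<sigma> s i w) (w i) > 0"
  shows "(\<forall>i<n. w i = (play_state i, play_action i)) \<and> (\<forall>i<n - 1. play_survival i > 0)"
  using assms
proof (induction n)
  case (Suc n)
  have "(\<forall>i<n. w i = (play_state i, play_action i)) \<and> (\<forall>i<n - 1. play_survival i > 0)"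
    by (rule Suc.IH; intro Suc.prems less_SucI)
  then have IH: "i < n \<Longrightarrow> w i = (play_state i, play_action i)" "i < n - 1 \<Longrightarrow> play_survival i > 0" for i
    by blast+
  let ?M = "if n = 0 then return_pmf s else p (fst (w (n - 1))) (snd (w (n - 1)))"
  have "pmf ?M (fst (w n)) * pmf (\<sigma> (map w [0..<n], fst (w n))) (snd (w n)) > 0"
    using Suc.prems(2)[of n] pmf_play_kernel[of p \<sigma> s n w "fst (w n)" "snd (w n)"] by simp
  then have pos: "pmf ?M (fst (w n)) > 0" "pmf (\<sigma> (map w [0..<n], fst (w n))) (snd (w n)) > 0"
    by (simp_all add: zero_less_mult_iff pmf_nonneg[THEN leD])
  \<comment> \<open>The new entry \<open>w n\<close> avoids the target with positive probability,
    which settles the transition \<open>n - 1\<close> missing from the induction hypothesis.\<close>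
  have surv: "play_survival i > 0" if "i < n" for i
  proof (cases "Suc i = n")
    case True
    then have "pmf (p (play_state i) (play_action i)) (fst (w n)) > 0"
      using pos(1) IH(1)[of i] by (auto split: if_splits)
    then show ?thesis
      using Suc.prems(1)[of n] by (intro survival_pos_of_pmf_pos) auto
  next
    case False
    then show ?thesis
      using that by (intro IH(2)) simp
  qed
  have x: "fst (w n) = play_state n"
  proof (cases n)
    case 0
    then have "fst (w n) = s"
      using pos(1) by (auto simp: indicator_def split: if_splits)
    with 0 show ?thesis
      by simp
  next
    case (Suc m)
    have m: "is_history A p target (surviving_play p target \<sigma> s m) \<and> play_state m \<noteq> target"
      using surv Suc by (intro surviving_play_valid) auto
    have "fst (w n) \<in> set_pmf (p (play_state m) (play_action m))"
      using pos(1) IH(1)[of m] Suc by (auto simp: set_pmf_iff)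
    then show ?thesis
      using set_pmf_subset_successor[OF det _ strategy_surviving_play(2), of m] m
        Suc Suc.prems(1)[of n] by (auto simp: play_state_Suc)
  qed
  have "map w [0..<n] = map (\<lambda>i. (play_state i, play_action i)) [0..<n]"
    using IH(1) by auto
  with x have "(map w [0..<n], fst (w n)) = surviving_play p target \<sigma> s n"
    by (simp add: surviving_play_eq)
  then have "pmf (return_pmf (play_action n)) (snd (w n)) > 0"
    using pos(2) strategy_surviving_play(1)[of n] surviving_play_valid[of n] surv by simp
  then have "snd (w n) = play_action n"
    by (auto simp: indicator_def split: if_splits)
  with x have "w n = (play_state n, play_action n)"
    by (simp add: prod_eq_iff)
  with IH(1) surv show ?case
    by (simp add: less_Suc_eq)
qed simp

lemma pmf_play_kernel_surviving_play:
  assumes "\<And>i. i < n \<Longrightarrow> play_survival i > 0"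
  shows "pmf (play_kernel p \<sigma> s n (\<lambda>i. (play_state i, play_action i))) (play_state n, play_action n)
    = (if n = 0 then 1 else play_survival (n - 1))"
proof -
  have v: "is_history A p target (surviving_play p target \<sigma> s n)"
    using surviving_play_valid assms by blast
  have "pmf (p (play_state m) (play_action m)) (play_state n) = play_survival m" if "n = Suc m" for m
  proof -
    have m: "is_history A p target (surviving_play p target \<sigma> s m) \<and> play_state m \<noteq> target"
      using assms that by (intro surviving_play_valid) auto
    then show ?thesis
      using survival_pos_imp[OF det _ strategy_surviving_play(2), of m] assms[of m] that
      by (simp add: play_state_Suc)
  qed
  moreover have "\<sigma> (map (\<lambda>i. (play_state i, play_action i)) [0..<n], play_state n) = return_pmf (play_action n)"
    using strategy_surviving_play(1)[OF v] by (simp only: surviving_play_eq)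
  ultimately show ?thesis
    by (cases n) (simp_all add: pmf_play_kernel del: upt_Suc)
qed

text \<open>The event is a finite disjoint union of cylinders, of which only the one around the
  surviving play can have positive mass. The \<open>n\<close> states involve \<open>n - 1\<close>
  transitions.\<close>

lemma prob_avoid_target:
  "measure (play_measure p \<sigma> s) {\<omega>. \<forall>i<n. fst (\<omega> i) \<noteq> target} = (\<Prod>i<n - 1. play_survival i)"
proof -
  interpret prob_space "play_measure p \<sigma> s"
    by (rule prob_space_play_measure)
  \<comment> \<open>Extensional functions give exactly one representative per prefix, which makes
    the union finite and disjoint.\<close>
  let ?W = "{..<n} \<rightarrow>\<^sub>E {z :: 's \<times> 'a. fst z \<noteq> target}"
  let ?C = "\<lambda>w. {\<omega>. \<forall>i<n. \<omega> i = w i}"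
  let ?x = "\<lambda>i. (play_state i, play_action i)"
  have avoids: "fst (w i) \<noteq> target" if "w \<in> ?W" "i < n" for w i
    using PiE_mem[OF that(1), of i] that(2) by simp
  have fin: "finite ?W"
    by (intro finite_PiE finite_lessThan finite)
  have "{\<omega>. \<forall>i<n. fst (\<omega> i) \<noteq> target} = (\<Union>w\<in>?W. ?C w)"
  proof (intro equalityI subsetI)
    fix \<omega> :: "nat \<Rightarrow> 's \<times> 'a" assume "\<omega> \<in> {\<omega>. \<forall>i<n. fst (\<omega> i) \<noteq> target}"
    then show "\<omega> \<in> (\<Union>w\<in>?W. ?C w)"
      by (intro UN_I[of "restrict \<omega> {..<n}"]) (auto simp: PiE_iff)
  qed (auto simp: PiE_iff)
  then have "prob {\<omega>. \<forall>i<n. fst (\<omega> i) \<noteq> target} = prob (\<Union>w\<in>?W. ?C w)"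
    by simp
  also have "\<dots> = (\<Sum>w\<in>?W. prob (?C w))"
  proof (rule finite_measure_finite_Union)
    show "disjoint_family_on ?C ?W"
      unfolding disjoint_family_on_def
    proof (intro ballI impI)
      fix v w assume vw: "v \<in> ?W" "w \<in> ?W" "v \<noteq> w"
      have "\<exists>i<n. v i \<noteq> w i"
      proof (rule ccontr)
        assume "\<not> ?thesis"
        then have "v = w"
          by (intro PiE_ext[OF vw(1,2)]) auto
        with vw(3) show False ..
      qed
      then show "?C v \<inter> ?C w = {}"
        by auto
    qed
  qed (use fin cylinder_in_sets in auto)
  also have "\<dots> = (\<Prod>i<n - 1. play_survival i)"
  proof (cases "\<forall>i<n - 1. play_survival i > 0")
    case True
    have x: "restrict ?x {..<n} \<in> ?W"
    proof -
      have "play_state i \<noteq> target" if "i < n" for i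
        using surviving_play_valid[of i] True that by simp
      then show ?thesis
        by simp
    qed
    have "prob (?C w) = 0" if w: "w \<in> ?W" "w \<noteq> restrict ?x {..<n}" for w
    proof (rule ccontr)
      assume "prob (?C w) \<noteq> 0"
      then have "\<And>i. i < n \<Longrightarrow> pmf (play_kernel p \<sigma> s i w) (w i) > 0"
        by (simp add: measure_play_cylinder pmf_positive_iff set_pmf_iff)
      moreover have "\<And>i. i < n \<Longrightarrow> fst (w i) \<noteq> target"
        by (rule avoids[OF w(1)])
      ultimately have "\<And>i. i < n \<Longrightarrow> w i = ?x i"
        using surviving_play_unique[of n w] by blast
      then have "w = restrict ?x {..<n}"
        by (intro PiE_ext[OF w(1) x]) simp
      with w(2) show False ..
    qed
    then have "(\<Sum>w\<in>?W. prob (?C w)) = prob (?C (restrict ?x {..<n}))"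
      unfolding sum.remove[OF fin x, of "\<lambda>w. prob (?C w)"]
      by (subst sum.neutral) auto
    also have "?C (restrict ?x {..<n}) = ?C ?x"
      by auto
    also have "prob (?C ?x) = (\<Prod>i<n. if i = 0 then 1 else play_survival (i - 1))"
      unfolding measure_play_cylinder
      using True by (intro prod.cong refl pmf_play_kernel_surviving_play) auto
    also have "\<dots> = (\<Prod>i<n - 1. play_survival i)"
      by (cases n) (simp_all add: prod.lessThan_Suc_shift del: prod.lessThan_Suc)
    finally show ?thesis .
  next
    case False
    \<comment> \<open>A cylinder of positive mass would make all these survival factors positive, so
      both sides are 0.\<close>
    have "prob (?C w) = 0" if w: "w \<in> ?W" for w
    proof (rule ccontr)
      assume "prob (?C w) \<noteq> 0"
      then have "\<And>i. i < n \<Longrightarrow> pmf (play_kernel p \<sigma> s i w) (w i) > 0"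
        by (simp add: measure_play_cylinder pmf_positive_iff set_pmf_iff)
      moreover have "\<And>i. i < n \<Longrightarrow> fst (w i) \<noteq> target"
        by (rule avoids[OF w(1)])
      ultimately show False
        using surviving_play_unique[of n w] False by blast
    qed
    moreover have "(\<Prod>i<n - 1. play_survival i) = 0"
    proof -
      obtain i where i: "i < n - 1" "\<not> play_survival i > 0"
        using False by blast
      then have "play_survival i = 0"
        using survival_nonneg[of p target "play_state i" "play_action i"] by simp
      with i(1) show ?thesis
        by (intro prod_zero) auto
    qed
    ultimately show ?thesis
      by simp
  qed
  finally show ?thesis .
qed

lemma reach_prob_eq: "reach_prob p target \<sigma> s t = 1 - (\<Prod>i<t - 1. play_survival i)"
proof -
  interpret prob_space "play_measure p \<sigma> s"
    by (rule prob_space_play_measure)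
  let ?H = "{\<omega> \<in> space (play_measure p \<sigma> s). hitting_time target \<omega> \<le> enat t}"
  have "reach_prob p target \<sigma> s t = 1 - prob (space (play_measure p \<sigma> s) - ?H)"
    unfolding reach_prob_def using prob_compl[OF sets_hitting_time_le[of p \<sigma> s target t]] by simp
  also have "space (play_measure p \<sigma> s) - ?H = {\<omega>. \<forall>i<t. fst (\<omega> i) \<noteq> target}"
    by (auto simp: hitting_time_le_iff space_play_measure)
  finally show ?thesis
    by (simp only: prob_avoid_target)
qed

end

end

section \<open>Optimality of the combined strategy\<close>

text \<open>The number counts the moves to successors before an action of survival 0. An earlier
  move of survival 0 has an arbitrary successor; this is harmless, as its state already satisfies
  the case \<open>0\<close>.\<close>

primrec can_surely_hit ::
    "('s \<Rightarrow> 'a set) \<Rightarrow> ('s \<Rightarrow> 'a \<Rightarrow> 's pmf) \<Rightarrow> 's \<Rightarrow> nat \<Rightarrow> 's \<Rightarrow> bool" where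
  "can_surely_hit A p target 0 s \<longleftrightarrow> (\<exists>a\<in>A s. survival p target s a = 0)"
| "can_surely_hit A p target (Suc n) s \<longleftrightarrow> (\<exists>a\<in>A s. can_surely_hit A p target n (successor p target s a))"

text \<open>Take the first action of a shortest such sequence. Its length is below every admissible
  \<open>n\<close>, so one action serves all \<open>n\<close> and the count strictly
  decreases.\<close>

lemma ex_hitting_action:
  assumes "A s \<noteq> {}"
  shows "\<exists>a\<in>A s. \<forall>n. can_surely_hit A p target n s \<longrightarrow>
    survival p target s a = 0 \<or> (\<exists>m<n. can_surely_hit A p target m (successor p target s a))"
proof (cases "\<exists>n. can_surely_hit A p target n s")
  case True
  define k where "k = (LEAST n. can_surely_hit A p target n s)"
  have k: "can_surely_hit A p target k s"
    unfolding k_def using True by (rule LeastI_ex)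
  have le: "k \<le> n" if "can_surely_hit A p target n s" for n
    unfolding k_def using that by (rule Least_le)
  show ?thesis
  proof (cases k)
    case 0
    with k show ?thesis by auto
  next
    case (Suc m)
    with k obtain a where "a \<in> A s" "can_surely_hit A p target m (successor p target s a)"
      by auto
    with le Suc show ?thesis
      by (metis Suc_le_lessD)
  qed
next
  case False
  with assms show ?thesis by blast
qed

text \<open>The states without a sure hit are closed under all actions, and survival there is
  positive, so logarithms are meaningful.\<close>

lemma survival_pos_of_not_can_surely_hit:
  assumes "\<And>n. \<not> can_surely_hit A p target n s" "a \<in> A s"
  shows "survival p target s a > 0" "\<not> can_surely_hit A p target n (successor p target s a)"
  using assms(1)[of 0] assms(1)[of "Suc n"] assms(2) survival_nonneg[of p target s a]
  by (force simp: less_le)+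

theorem theorem4:
  fixes A :: "'s :: finite \<Rightarrow> 'a :: finite set"
    and p :: "'s \<Rightarrow> 'a \<Rightarrow> 's pmf"
    and target :: 's
  assumes "\<And>s. A s \<noteq> {}"
    and "deterministic_mdp A p target"
  shows "\<exists>\<sigma>. is_strategy A p target \<sigma> \<and> is_pure A p target \<sigma> \<and> is_stationary A p target \<sigma> \<and>
           (\<forall>s. s \<noteq> target \<longrightarrow>
              (\<forall>\<sigma>'. is_strategy A p target \<sigma>' \<longrightarrow> is_pure A p target \<sigma>' \<longrightarrow> \<sigma>' \<noteq> \<sigma> \<longrightarrow>
                 \<not> weakly_overtakes_at p target \<sigma>' \<sigma> s))"
proof -
  let ?q = "survival p target" and ?nxt = "successor p target" and ?W = "\<lambda>s. \<exists>n. can_surely_hit A p target n s"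
  \<comment> \<open>The logarithm turns products of survival factors into sums. Where survival is 0
    the reward is a mere default; the comparison below uses only walks that never meet such a
    factor.\<close>
  interpret reward_graph A ?nxt "\<lambda>s a. - ln (?q s a)"
    by standard (rule assms(1))
  obtain f where f: "\<And>s. f s \<in> A s"
    and not_overtaken: "\<And>x b T. walk x b \<Longrightarrow> (\<And>n. n \<ge> T \<Longrightarrow> (\<Sum>i<n. gap f x b i) \<ge> 0) \<Longrightarrow>
       finite {n. (\<Sum>i<n. gap f x b i) > 0}"
    using ex_not_overtaken by metis
  obtain g where g: "\<And>s. g s \<in> A s"
    and g_hit: "\<And>s n. can_surely_hit A p target n s \<Longrightarrow>
      ?q s (g s) = 0 \<or> (\<exists>m<n. can_surely_hit A p target m (?nxt s (g s)))"
    using ex_hitting_action[of A _ p target, OF assms(1)] by metis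
  define F where "F s = (if ?W s then g s else f s)" for s
  define \<sigma> :: "('s, 'a) strategy" where "\<sigma> h = return_pmf (F (final_state h))" for h
  have F: "F s \<in> A s" for s
    using f g by (simp add: F_def)
  have strategy: "is_strategy A p target \<sigma>"
    by (simp add: is_strategy_def \<sigma>_def F)
  have pure: "is_pure A p target \<sigma>"
    unfolding is_pure_def \<sigma>_def by (metis indicator_simps(1) pmf_return singletonI)
  have stationary: "is_stationary A p target \<sigma>"
    by (simp add: is_stationary_def \<sigma>_def)
  have action: "play_action p target \<sigma> s n = F (play_state p target \<sigma> s n)" for s n
    unfolding play_action_def by (rule some_equality) (auto simp: \<sigma>_def play_state_def indicator_def split: if_splits)
  have state: "play_state p target \<sigma> s n = orbit F s n" for s n
    by (induction n) (simp_all add: play_state_Suc action)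
  have reach: "reach_prob p target \<sigma> s t = 1 - (\<Prod>i<t - 1. ?q (orbit F s i) (F (orbit F s i)))"
    if "s \<noteq> target" for s t
    using reach_prob_eq[OF assms(2) strategy pure that, of t] by (simp add: action state)
  have hit: "\<exists>i. ?q (orbit F s i) (F (orbit F s i)) = 0" if "can_surely_hit A p target n s" for n s
    using that
  proof (induction n arbitrary: s rule: less_induct)
    case (less n)
    then have Fs: "F s = g s"
      by (auto simp: F_def)
    from g_hit[OF less.prems] show ?case
    proof
      assume "?q s (g s) = 0"
      then show ?thesis
        by (intro exI[of _ 0]) (simp add: Fs)
    next
      assume "\<exists>m<n. can_surely_hit A p target m (?nxt s (g s))"
      then obtain i where "?q (orbit F (?nxt s (F s)) i) (F (orbit F (?nxt s (F s)) i)) = 0"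
        using less.IH Fs by metis
      then show ?thesis
        using orbit_add[of F s 1 i] by (intro exI[of _ "1 + i"]) (simp del: orbit_Suc add: orbit_Suc[of F s 0, simplified])
    qed
  qed
  have "\<not> weakly_overtakes_at p target \<sigma>' \<sigma> s"
    if s: "s \<noteq> target" and \<sigma>': "is_strategy A p target \<sigma>'" "is_pure A p target \<sigma>'" for s \<sigma>'
  proof
    assume "weakly_overtakes_at p target \<sigma>' \<sigma> s"
    then obtain T where T: "\<And>t. t \<ge> T \<Longrightarrow> reach_prob p target \<sigma>' s t \<ge> reach_prob p target \<sigma> s t"
      and inf: "infinite {t. reach_prob p target \<sigma>' s t > reach_prob p target \<sigma> s t}"
      unfolding weakly_overtakes_at_def by blast
    let ?x = "play_state p target \<sigma>' s" and ?b = "play_action p target \<sigma>' s"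
    note reach' = reach_prob_eq[OF assms(2) \<sigma>' s]
    show False
    proof (cases "?W s")
      case True
      then obtain i where i: "?q (orbit F s i) (F (orbit F s i)) = 0"
        using hit by blast
      \<comment> \<open>Once \<open>t - 1 > i\<close>, the product contains the zero factor, so
        \<open>\<sigma>\<close> has reached the target with probability 1 and cannot be
        exceeded.\<close>
      have "t \<le> Suc i" if "reach_prob p target \<sigma>' s t > reach_prob p target \<sigma> s t" for t
      proof (rule ccontr)
        assume "\<not> t \<le> Suc i"
        then have "(\<Prod>j<t - 1. ?q (orbit F s j) (F (orbit F s j))) = 0"
          using i by (intro prod_zero) auto
        then have "reach_prob p target \<sigma> s t = 1"
          by (simp add: reach[OF s])
        moreover have "reach_prob p target \<sigma>' s t \<le> 1"
          unfolding reach' by (simp add: prod_nonneg survival_nonneg)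
        ultimately show False
          using that by simp
      qed
      then have "{t. reach_prob p target \<sigma>' s t > reach_prob p target \<sigma> s t} \<subseteq> {..Suc i}"
        by blast
      with inf show False
        using finite_subset by blast
    next
      case False
      \<comment> \<open>Positive survival so far makes the play a genuine history, so the next
        action is admissible; hence survival stays positive and the play stays outside
        \<open>?W\<close>.\<close>
      have x: "\<not> ?W (?x n) \<and> (\<forall>i<n. ?q (?x i) (?b i) > 0) \<and> (\<forall>i<n. ?b i \<in> A (?x i))" for n
      proof (induction n)
        case 0
        then show ?case
          using False by simp
      next
        case (Suc n)
        then have "is_history A p target (surviving_play p target \<sigma>' s n)"
          using surviving_play_valid[OF assms(2) \<sigma>' s, of n] by blast
        then have a: "?b n \<in> A (?x n)"
          by (rule strategy_surviving_play[OF assms(2) \<sigma>' s])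
        have "\<not> can_surely_hit A p target m (?x n)" for m
          using Suc by blast
        from survival_pos_of_not_can_surely_hit[OF this a] Suc a show ?case
          by (auto simp: play_state_Suc less_Suc_eq)
      qed
      then have q': "?q (?x n) (?b n) > 0" and "?b n \<in> A (?x n)" for n
        by (blast intro: lessI)+
      then have w: "walk ?x ?b"
        by (simp add: walk_def play_state_Suc)
      \<comment> \<open>Outside \<open>?W\<close> the combined policy is \<open>f\<close>, and its
        play never enters \<open>?W\<close>.\<close>
      have y: "orbit F s n = orbit f s n \<and> \<not> ?W (orbit f s n)" for n
      proof (induction n)
        case 0
        then show ?case
          using False by simp
      next
        case (Suc n)
        then have "F (orbit f s n) = f (orbit f s n)"
          by (simp add: F_def)
        moreover have "\<not> can_surely_hit A p target m (?nxt (orbit f s n) (f (orbit f s n)))" for m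
          using Suc f by (intro survival_pos_of_not_can_surely_hit(2)) auto
        ultimately show ?case
          using Suc by simp
      qed
      then have Fy: "F (orbit f s n) = f (orbit f s n)" for n
        by (simp add: F_def)
      have q: "?q (orbit f s n) (f (orbit f s n)) > 0" for n
        using y[of n] f by (intro survival_pos_of_not_can_surely_hit(1)) auto
      have sum_gap: "(\<Sum>i<n. gap f ?x ?b i)
          = ln (\<Prod>i<n. ?q (orbit f s i) (f (orbit f s i))) - ln (\<Prod>i<n. ?q (?x i) (?b i))" for n
        using q[THEN less_imp_neq, THEN not_sym] q'[THEN less_imp_neq, THEN not_sym]
        by (simp add: ln_prod gap_def sum_subtractf sum_negf)
      \<comment> \<open>By strict monotonicity of \<open>ln\<close>, a larger reward means less
        survival. The first \<open>n\<close> transitions decide reaching by period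
        \<open>Suc n\<close>.\<close>
      have gap_iff: "(\<Sum>i<n. gap f ?x ?b i) \<ge> 0 \<longleftrightarrow> reach_prob p target \<sigma>' s (Suc n) \<ge> reach_prob p target \<sigma> s (Suc n)"
        "(\<Sum>i<n. gap f ?x ?b i) > 0 \<longleftrightarrow> reach_prob p target \<sigma>' s (Suc n) > reach_prob p target \<sigma> s (Suc n)" for n
        using q q' y by (simp_all add: sum_gap reach[OF s] reach' Fy prod_pos)
      have "finite {n. (\<Sum>i<n. gap f ?x ?b i) > 0}"
        using T by (intro not_overtaken[OF w, of T]) (simp add: gap_iff)
      \<comment> \<open>The inserted 0 covers the period \<open>t = 0\<close>, which is no
        \<open>Suc n\<close>.\<close>
      then have "finite (insert 0 (Suc ` {n. (\<Sum>i<n. gap f ?x ?b i) > 0}))"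
        by simp
      moreover have "{t. reach_prob p target \<sigma>' s t > reach_prob p target \<sigma> s t}
          \<subseteq> insert 0 (Suc ` {n. (\<Sum>i<n. gap f ?x ?b i) > 0})"
      proof
        fix t assume "t \<in> {t. reach_prob p target \<sigma>' s t > reach_prob p target \<sigma> s t}"
        then show "t \<in> insert 0 (Suc ` {n. (\<Sum>i<n. gap f ?x ?b i) > 0})"
          by (cases t) (simp_all add: gap_iff)
      qed
      ultimately show False
        using inf finite_subset by blast
    qed
  qed
  with strategy pure stationary show ?thesis
    by blast
qed

end
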